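(* Let $X$ be an infinite-dimensional complex Banach space. For $T\in\mathcal{B}(X)$, the following statements are equivalent: (i) $T$ is right Drazin invertible. (ii) $T^m$ is right Drazin invertible for all $m\in\mathbb{N}$. (iii) $T^m$ is right Drazin invertible for some $m\in\mathbb{N}$. Likewise, the following statements are equivalent: (i') $T$ is essentially right Drazin invertible. (ii') $T^m$ is essentially right Drazin invertible for all $m\in\mathbb{N}$. (iii') $T^m$ is essentially right Drazin invertible for some $m\in\mathbb{N}$.
   Context: $\mathcal{B}(X)$ is the algebra of bounded linear operators on $X$; $\mathcal{N}(T)$, $\mathcal{R}(T)$ denote kernel and range; $\mathbb{N}_0=\{0,1,2,\dots\}$, $\mathbb{N}=\{1,2,\dots\}$; the infimum of the empty set is $\infty$. A subspace of $X$ is topologically complemented if it is closed and has a closed algebraic complement in $X$. The descent $d(T)$ is the smallest $n\in\mathbb{N}_0$ with $\mathcal{R}(T^n)=\mathcal{R}(T^{n+1})$, and the essential descent $d_e(T)$ is the smallest $n\in\mathbb{N}_0$ with $\operatorname{codim}(\mathcal{R}(T)+\mathcal{N}(T^n))<\infty$ ($\infty$ if there is none). The degree of stable iteration is $\operatorname{dis}(T)=\inf\{n\in\mathbb{N}_0: m\ge n,\ m\in\mathbb{N}\Rightarrow \mathcal{N}(T)\cap\mathcal{R}(T^n)=\mathcal{N}(T)\cap\mathcal{R}(T^m)\}$. $T$ is right Drazin invertible if $q:=d(T)<\infty$ and $\mathcal{N}(T)\cap\mathcal{R}(T^q)$ is topologically complemented in $X$. $T$ is essentially right Drazin invertible if $d_e(T)<\infty$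 and $\mathcal{N}(T)\cap\mathcal{R}(T^{\operatorname{dis}(T)})$ is topologically complemented in $X$. *)

theory Defs
  imports "HOL-Analysis.Analysis" "HOL-Library.Set_Algebras"
begin

class complex_banach = banach +
  fixes scaleC :: "complex \<Rightarrow> 'a \<Rightarrow> 'a" (infixr "*\<^sub>C" 75)
  assumes scaleC_add_right: "c *\<^sub>C (x + y) = c *\<^sub>C x + c *\<^sub>C y"
    and scaleC_add_left: "(c + d) *\<^sub>C x = c *\<^sub>C x + d *\<^sub>C x"
    and scaleC_scaleC: "c *\<^sub>C d *\<^sub>C x = (c * d) *\<^sub>C x"
    and scaleC_of_real: "complex_of_real r *\<^sub>C x = r *\<^sub>R x"
    and norm_scaleC: "norm (c *\<^sub>C x) = cmod c * norm x"

global_interpretation complex_vector: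
  vector_space "scaleC :: complex \<Rightarrow> 'a \<Rightarrow> 'a::complex_banach"
proof
  show "1 *\<^sub>C x = x" for x :: 'a
    using scaleC_of_real[of 1 x] by simp
qed (simp_all add: scaleC_add_right scaleC_add_left scaleC_scaleC)

definition bounded_operator :: "('a::complex_banach \<Rightarrow> 'a) \<Rightarrow> bool" where
  "bounded_operator T \<longleftrightarrow> bounded_linear T \<and> (\<forall>c x. T (c *\<^sub>C x) = c *\<^sub>C T x)"

definition ker :: "('a \<Rightarrow> 'a::complex_banach) \<Rightarrow> 'a set" where
  "ker T = {x. T x = 0}"

text \<open>Here \<open>M + N\<close> is the elementwise sum of the two sets.\<close>
definition topologically_complemented :: "'a::complex_banach set \<Rightarrow> bool" where
  "topologically_complemented M \<longleftrightarrow>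
     complex_vector.subspace M \<and> closed M \<and>
     (\<exists>N. complex_vector.subspace N \<and> closed N \<and> M \<inter> N = {0} \<and> M + N = UNIV)"

text \<open>The dimension of the quotient by \<open>M\<close>: the least number of vectors whose cosets span the
  quotient. In \<^typ>\<open>enat\<close>, the infimum of the empty set is \<open>\<infinity>\<close>; the same convention is used for
  all infima below.\<close>
definition codim :: "'a::complex_banach set \<Rightarrow> enat" where
  "codim M = Inf {enat (card B) | B. finite B \<and> complex_vector.span (M \<union> B) = UNIV}"

definition descent :: "('a::complex_banach \<Rightarrow> 'a) \<Rightarrow> enat" where
  "descent T = Inf {enat n | n. range (T ^^ n) = range (T ^^ (n + 1))}"

definition essential_descent :: "('a::complex_banach \<Rightarrow> 'a) \<Rightarrow> enat" where
  "essential_descent T = Inf {enat n | n. codim (range T + ker (T ^^ n)) < \<infinity>}"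

definition dis :: "('a::complex_banach \<Rightarrow> 'a) \<Rightarrow> enat" where
  "dis T = Inf {enat n | n. \<forall>m. m \<ge> n \<and> m \<ge> 1 \<longrightarrow>
     ker T \<inter> range (T ^^ n) = ker T \<inter> range (T ^^ m)}"

definition right_drazin_invertible :: "('a::complex_banach \<Rightarrow> 'a) \<Rightarrow> bool" where
  "right_drazin_invertible T \<longleftrightarrow>
     (\<exists>q. descent T = enat q \<and> topologically_complemented (ker T \<inter> range (T ^^ q)))"

text \<open>Finiteness of \<^term>\<open>dis T\<close> is no extra condition: for bounded operators it follows from
  finiteness of the essential descent.\<close>
definition essentially_right_drazin_invertible :: "('a::complex_banach \<Rightarrow> 'a) \<Rightarrow> bool" where
  "essentially_right_drazin_invertible T \<longleftrightarrow> essential_descent T < \<infinity> \<and>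
     (\<exists>n. dis T = enat n \<and> topologically_complemented (ker T \<inter> range (T ^^ n)))"

end

theory Submission
  imports Defs
begin

text \<open>
  Both equivalences follow from one fact: for \<open>m \<ge> 1\<close>, the operator \<open>T\<close> is (essentially) right Drazin
  invertible exactly when \<open>T ^^ m\<close> is. The finiteness conditions and the complementation
  condition transfer separately.

  For the complementation, suppose that \<open>ker T \<inter> range (T ^^ n)\<close> no longer changes as \<open>n\<close> grows
  (\<open>kernel_stable_from T n\<close>; both forms of invertibility provide such an \<open>n\<close>), and put
  \<open>K j = ker (T ^^ j) \<inter> range (T ^^ n)\<close>. Then \<open>K j\<close> lies in the range of every power of \<open>T\<close>, so
  \<open>T\<close> maps \<open>K (Suc j)\<close> onto \<open>K j\<close> with kernel \<open>K 1\<close>. The point is that this surjection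
  has a bounded right inverse as soon as \<open>K 1\<close> is complemented, although \<open>range (T ^^ n)\<close> need not be
  closed (\<open>lift_through_operator\<close>): if \<open>P\<close> is a bounded projection onto \<open>K 1\<close>, then
  \<open>T ^^ n u - P (T ^^ n u)\<close> depends only on \<open>T ^^ Suc n u\<close>, and the open mapping principle lets
  \<open>u\<close> be chosen with norm controlled by that of \<open>T ^^ Suc n u\<close> when the latter ranges over the closed
  subspace \<open>K j\<close>.

  With these right inverses, projections can be written down in both directions. If \<open>P\<close> and \<open>Pj\<close> are
  projections onto \<open>K 1\<close> and \<open>K j\<close>, and \<open>C\<close> has values in \<open>range (T ^^ n)\<close> with
  \<open>T (C x) = Pj (T x)\<close>, then \<open>x \<mapsto> C x + P (x - C x)\<close> is a projection onto \<open>K (Suc j)\<close>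
  (\<open>complemented_kernel_funpow\<close>). Conversely, if \<open>P\<close> projects onto
  \<open>K m\<close>, then lifting \<open>P\<close> through \<open>T ^^ m\<close> gives \<open>C\<close> with \<open>(T ^^ m) (C x) = P x\<close>, and
  \<open>x \<mapsto> P x - (T ^^ (m - 1)) (C (T (P x)))\<close> is a projection onto \<open>K 1\<close>
  (\<open>complemented_kernel_of_funpow\<close>).

  Finiteness is algebra. For the descent, the ranges of the powers of \<open>T ^^ m\<close> are a
  subsequence of the decreasing sequence \<open>range (T ^^ n)\<close>; for stable iteration,
  \<open>ker T\<close> lies in \<open>ker (T ^^ m)\<close>, and each \<open>K m\<close> inherits stability from \<open>K 1\<close>. For the essential
  descent, applying \<open>T\<close> to a decomposition of the space into \<open>range T\<close>, \<open>ker (T ^^ n)\<close> and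
  finitely many directions replaces \<open>range T\<close> by the range of a higher power at the cost of finitely many further
  directions (\<open>cofinite_range_funpow\<close>).
\<close>

section \<open>The open mapping principle for closed linear relations\<close>

lemma Baire_closure_cover:
  fixes D :: "nat \<Rightarrow> 'a::complete_space set"
  assumes cover: "(\<Union>n. closure (D n)) = UNIV"
  shows "\<exists>n. interior (closure (D n)) \<noteq> {}"
proof (rule ccontr)
  assume no: "\<nexists>n. interior (closure (D n)) \<noteq> {}"
  have "(euclidean :: 'a topology) interior_of \<Union> (range (\<lambda>n. closure (D n))) = {}"
    unfolding mtopology_is_euclidean[symmetric]
  proof (rule Met_TC.metric_Baire_category_alt)
    show "Met_TC.mcomplete TYPE('a)" by (simp only: mcomplete_iff_complete complete_UNIV)
    show "countable (range (\<lambda>n. closure (D n)))" by simp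
    show "closedin Met_TC.mtopology S \<and> Met_TC.mtopology interior_of S = {}"
      if "S \<in> range (\<lambda>n. closure (D n))" for S
      using that no by (auto simp: mtopology_is_euclidean)
  qed
  then show False using cover by simp
qed

text \<open>The open mapping theorem, in a form that covers operators on closed subspaces and closed graphs
  at once. By Baire, the points \<open>x\<close> that are related to some \<open>u\<close> with \<open>norm u \<le> n\<close>
  are dense in a ball for some \<open>n\<close>; by linearity, every \<open>x\<close> can then be approximated, to within half
  its norm, by a point related to some \<open>u\<close> of norm at most \<open>K * norm x\<close>. Repeating this with the
  remainder and summing the \<open>u\<close> gives the exact selection.\<close>
lemma closed_relation_bounded_selection:
  fixes G :: "('x::banach \<times> 'y::banach) set"
  assumes "subspace G" "closed G" and total: "\<And>x. \<exists>u. (x, u) \<in> G"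
  obtains M where "M > 0" "\<And>x. \<exists>u. (x, u) \<in> G \<and> norm u \<le> M * norm x"
proof -
  define D where "D n = {x. \<exists>u. (x, u) \<in> G \<and> norm u \<le> real n}" for n :: nat
  have "x \<in> (\<Union>n. closure (D n))" for x
  proof -
    obtain u where "(x, u) \<in> G" using total by blast
    moreover obtain n where "norm u \<le> real n" using real_arch_simple by blast
    ultimately have "x \<in> D n" by (auto simp: D_def)
    then show ?thesis using closure_subset by blast
  qed
  then have "(\<Union>n. closure (D n)) = UNIV" by blast
  then have "\<exists>n. interior (closure (D n)) \<noteq> {}" by (rule Baire_closure_cover)
  then obtain n a r where "r > 0" and ball: "ball a r \<subseteq> closure (D n)"
    by (metis ex_in_conv mem_interior)
  (* Scaling x to norm r / 2 and taking differences of points of D n gives the bound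
     2 * n * (2 * norm x / r) for the second component; the summand 1 only makes K positive. *)
  define K where "K = 4 * real n / r + 1"
  have "K > 0" using \<open>r > 0\<close> by (simp add: K_def add_nonneg_pos)
  have approx: "\<exists>x' u'. (x', u') \<in> G \<and> norm u' \<le> K * norm x \<and> norm (x - x') \<le> norm x / 2" for x
  proof (cases "x = 0")
    case True
    then show ?thesis using \<open>subspace G\<close> by (intro exI[of _ 0]) (auto simp: subspace_def zero_prod_def)
  next
    case False
    define c where "c = r / (2 * norm x)"
    have "c > 0" using False \<open>r > 0\<close> by (simp add: c_def)
    define e where "e = c * norm x / 4"
    have "e > 0" using \<open>c > 0\<close> False by (simp add: e_def)
    have "norm (c *\<^sub>R x) < r"
      using False \<open>r > 0\<close> by (simp add: c_def)
    then have "a + c *\<^sub>R x \<in> closure (D n)" "a \<in> closure (D n)"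
      using ball \<open>r > 0\<close> by (auto simp: subset_iff dist_norm)
    then obtain y z where y: "y \<in> D n" "dist y (a + c *\<^sub>R x) < e" and z: "z \<in> D n" "dist z a < e"
      using \<open>e > 0\<close> by (meson closure_approachable)
    obtain v w where v: "(y, v) \<in> G" "norm v \<le> n" and w: "(z, w) \<in> G" "norm w \<le> n"
      using y(1) z(1) by (auto simp: D_def)
    have "(y - z, v - w) \<in> G"
      using subspace_diff[OF \<open>subspace G\<close> v(1) w(1)] by simp
    then have mem: "((y - z) /\<^sub>R c, (v - w) /\<^sub>R c) \<in> G"
      using subspace_scale[OF \<open>subspace G\<close>, of _ "inverse c"] by fastforce
    have "norm (v - w) \<le> 2 * n" using v(2) w(2) norm_triangle_ineq4[of v w] by simp
    then have "norm ((v - w) /\<^sub>R c) \<le> 2 * n / c"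
      using \<open>c > 0\<close> by (simp add: divide_inverse_commute)
    also have "\<dots> = 4 * real n / r * norm x" by (simp add: c_def)
    also have "\<dots> \<le> K * norm x" by (simp add: K_def distrib_right)
    finally have bound: "norm ((v - w) /\<^sub>R c) \<le> K * norm x" .
    have "x - (y - z) /\<^sub>R c = ((a + c *\<^sub>R x - y) - (a - z)) /\<^sub>R c"
      using \<open>c > 0\<close> by (simp add: algebra_simps)
    also have "norm \<dots> = norm ((a + c *\<^sub>R x - y) - (a - z)) / c"
      using \<open>c > 0\<close> by (simp add: divide_inverse_commute)
    also have "\<dots> \<le> (e + e) / c"
      using y(2) z(2) norm_triangle_ineq4[of "a + c *\<^sub>R x - y" "a - z"] \<open>c > 0\<close>
      by (intro divide_right_mono) (auto simp: dist_norm norm_minus_commute)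
    also have "\<dots> = norm x / 2" using \<open>c > 0\<close> by (simp add: e_def)
    finally show ?thesis using mem bound by blast
  qed
  then obtain X U where XU: "\<And>x. (X x, U x) \<in> G" "\<And>x. norm (U x) \<le> K * norm x"
    "\<And>x. norm (x - X x) \<le> norm x / 2"
    by metis
  have "\<exists>u. (x, u) \<in> G \<and> norm u \<le> 2 * K * norm x" for x
  proof -
    (* What is left of x after k approximation steps. *)
    define rem where "rem k = ((\<lambda>x. x - X x) ^^ k) x" for k
    have rem_Suc: "rem (Suc k) = rem k - X (rem k)" for k by (simp add: rem_def)
    have rem_le: "norm (rem k) \<le> norm x * (1 / 2) ^ k" for k
    proof (induction k)
      case (Suc k)
      then show ?case using XU(3)[of "rem k"] by (simp add: rem_Suc)
    qed (simp add: rem_def)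
    have U_le: "norm (U (rem k)) \<le> K * norm x * (1 / 2) ^ k" for k
      using order_trans[OF XU(2)[of "rem k"] mult_left_mono[OF rem_le[of k]]] \<open>K > 0\<close>
      by (simp add: mult.assoc)
    have geo: "(\<lambda>k. K * norm x * (1 / 2) ^ k) sums (K * norm x * 2)"
      using sums_mult[OF geometric_sums[of "1/2::real"], of "K * norm x"] by simp
    have summ: "summable (\<lambda>k. U (rem k))"
      by (rule summable_comparison_test'[OF sums_summable[OF geo]]) (use U_le in auto)
    have "norm (\<Sum>k. U (rem k)) \<le> (\<Sum>k. K * norm x * (1 / 2) ^ k)"
      by (rule norm_suminf_le[OF U_le sums_summable[OF geo]])
    then have le: "norm (\<Sum>k. U (rem k)) \<le> 2 * K * norm x"
      using sums_unique[OF geo] by simp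
    have part: "(x - rem k, \<Sum>i<k. U (rem i)) \<in> G" for k
    proof (induction k)
      case 0
      then show ?case using subspace_0[OF \<open>subspace G\<close>] by (simp add: rem_def zero_prod_def)
    next
      case (Suc k)
      then show ?case
        using subspace_add[OF \<open>subspace G\<close> Suc XU(1)[of "rem k"]]
        by (simp add: rem_Suc algebra_simps)
    qed
    have "(\<lambda>k. norm x * (1 / 2) ^ k) \<longlonglongrightarrow> 0"
      by (intro tendsto_mult_right_zero LIMSEQ_power_zero) simp
    then have "rem \<longlonglongrightarrow> 0"
      by (rule Lim_null_comparison[rotated]) (use rem_le in auto)
    then have "(\<lambda>k. (x - rem k, \<Sum>i<k. U (rem i))) \<longlonglongrightarrow> (x - 0, \<Sum>k. U (rem k))"
      by (intro tendsto_Pair tendsto_diff tendsto_const summable_LIMSEQ[OF summ])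
    then have "(x, \<Sum>k. U (rem k)) \<in> G"
      using closed_sequentially[OF \<open>closed G\<close>, of "\<lambda>k. (x - rem k, \<Sum>i<k. U (rem i))"] part by simp
    with le show ?thesis by blast
  qed
  then show ?thesis using that[of "2 * K"] \<open>K > 0\<close> by simp
qed

section \<open>Bounded operators and projections\<close>

lemma bounded_operatorD:
  assumes "bounded_operator T"
  shows "bounded_linear T" "T (c *\<^sub>C x) = c *\<^sub>C T x" "T (x + y) = T x + T y"
    "T (x - y) = T x - T y" "T 0 = 0"
proof -
  from assms show bl: "bounded_linear T" and "T (c *\<^sub>C x) = c *\<^sub>C T x"
    by (auto simp: bounded_operator_def)
  from bounded_linear.linear[OF bl]
  show "T (x + y) = T x + T y" "T (x - y) = T x - T y" "T 0 = 0"
    by (auto simp: linear_add linear_diff linear_0)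
qed

lemma bounded_operatorI:
  assumes "\<And>x y. T (x + y) = T x + T y" "\<And>c x. T (c *\<^sub>C x) = c *\<^sub>C T x"
    "\<And>x. norm (T x) \<le> norm x * M"
  shows "bounded_operator T"
  unfolding bounded_operator_def
proof (intro conjI allI bounded_linear_intro)
  show "T (r *\<^sub>R x) = r *\<^sub>R T x" for r x
    using assms(2)[of "complex_of_real r" x] by (simp add: scaleC_of_real)
qed (use assms in auto)

lemma bounded_operator_zero: "bounded_operator (\<lambda>x. 0)"
  by (simp add: bounded_operator_def complex_vector.scale_zero_right)

lemma bounded_operator_ident: "bounded_operator (\<lambda>x. x)"
  by (simp add: bounded_operator_def bounded_linear_ident)

lemma bounded_operator_add:
  "bounded_operator S \<Longrightarrow> bounded_operator T \<Longrightarrow> bounded_operator (\<lambda>x. S x + T x)"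
  by (simp add: bounded_operator_def bounded_linear_add scaleC_add_right)

lemma bounded_operator_diff:
  "bounded_operator S \<Longrightarrow> bounded_operator T \<Longrightarrow> bounded_operator (\<lambda>x. S x - T x)"
  by (simp add: bounded_operator_def bounded_linear_sub complex_vector.scale_right_diff_distrib)

lemma bounded_operator_compose:
  "bounded_operator S \<Longrightarrow> bounded_operator T \<Longrightarrow> bounded_operator (\<lambda>x. S (T x))"
  by (simp add: bounded_operator_def bounded_linear_compose)

lemma bounded_operator_funpow:
  "bounded_operator T \<Longrightarrow> bounded_operator (T ^^ n)"
proof (induction n)
  case (Suc n)
  then show ?case using bounded_operator_compose[of T "T ^^ n"] by (simp add: comp_def)
qed (simp add: bounded_operator_ident id_def)

lemma complex_subspace_imp_subspace:
  assumes "complex_vector.subspace M"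
  shows "subspace M"
  using assms complex_vector.subspace_scale[OF assms, of _ "complex_of_real _"]
  by (auto simp: subspace_def complex_vector.subspace_def scaleC_of_real)

lemma subspace_ker:
  "bounded_operator T \<Longrightarrow> complex_vector.subspace (ker T)"
  by (auto simp: complex_vector.subspace_def ker_def bounded_operatorD complex_vector.scale_zero_right)

lemma subspace_range:
  assumes "bounded_operator T"
  shows "complex_vector.subspace (range T)"
  unfolding complex_vector.subspace_def
  by (safe; metis bounded_operatorD(2,3,5)[OF assms] rangeI)

lemma closed_ker: "bounded_operator T \<Longrightarrow> closed (ker T)"
  unfolding ker_def
  by (intro closed_Collect_eq continuous_intros linear_continuous_on bounded_operatorD)

text \<open>If \<open>K\<close> and \<open>N\<close> are complementary closed subspaces, the relation between \<open>x\<close> and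
  \<open>k \<in> K\<close> that says \<open>x - k \<in> N\<close> is closed, total and single-valued, hence the graph of a bounded
  operator.\<close>
lemma topologically_complemented_iff_projection:
  "topologically_complemented K \<longleftrightarrow>
    (\<exists>P. bounded_operator P \<and> range P \<subseteq> K \<and> (\<forall>x\<in>K. P x = x))"
proof
  assume "topologically_complemented K"
  then obtain N where K: "complex_vector.subspace K" "closed K"
    and N: "complex_vector.subspace N" "closed N" and "K \<inter> N = {0}" "K + N = UNIV"
    unfolding topologically_complemented_def by auto
  have "\<exists>k. k \<in> K \<and> x - k \<in> N" for x
  proof -
    have "x \<in> K + N" using \<open>K + N = UNIV\<close> by simp
    then show ?thesis by (auto elim!: set_plus_elim)
  qed
  then obtain P where P: "\<And>x. P x \<in> K" "\<And>x. x - P x \<in> N"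
    by metis
  have uniq: "P x = k" if "k \<in> K" "x - k \<in> N" for x k
  proof -
    have "P x - k \<in> K" by (rule complex_vector.subspace_diff[OF K(1) P(1) that(1)])
    moreover have "(x - k) - (x - P x) \<in> N"
      by (rule complex_vector.subspace_diff[OF N(1) that(2) P(2)])
    then have "P x - k \<in> N" by simp
    ultimately have "P x - k \<in> {0}" unfolding \<open>K \<inter> N = {0}\<close>[symmetric] by (rule IntI)
    then show ?thesis by simp
  qed
  let ?G = "{z. snd z \<in> K} \<inter> {z. fst z - snd z \<in> N}"
  have "subspace ?G"
    using complex_subspace_imp_subspace[OF K(1)] complex_subspace_imp_subspace[OF N(1)]
    by (auto simp: subspace_def add_diff_add simp flip: scaleR_diff_right)
  moreover have "closed ?G"
    using continuous_closed_vimage[OF K(2), of snd]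
      continuous_closed_vimage[OF N(2), of "\<lambda>z. fst z - snd z"]
    by (intro closed_Int) (auto simp: vimage_def intro!: continuous_intros)
  moreover have "\<exists>k. (x, k) \<in> ?G" for x by (intro exI[of _ "P x"]) (simp add: P)
  ultimately obtain M where M: "\<And>x. \<exists>k. (x, k) \<in> ?G \<and> norm k \<le> M * norm x"
    using closed_relation_bounded_selection[of ?G] by blast
  have "bounded_operator P"
  proof (rule bounded_operatorI)
    show "P (x + y) = P x + P y" for x y
      using complex_vector.subspace_add[OF K(1) P(1)[of x] P(1)[of y]]
        complex_vector.subspace_add[OF N(1) P(2)[of x] P(2)[of y]]
      by (intro uniq) (simp_all add: add_diff_add)
    show "P (c *\<^sub>C x) = c *\<^sub>C P x" for c x
      using complex_vector.subspace_scale[OF K(1) P(1)[of x]]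
        complex_vector.subspace_scale[OF N(1) P(2)[of x]]
      by (intro uniq) (simp_all add: complex_vector.scale_right_diff_distrib)
    show "norm (P x) \<le> norm x * M" for x
    proof -
      obtain k where "(x, k) \<in> ?G" "norm k \<le> M * norm x" using M by blast
      moreover from this have "P x = k" by (intro uniq) auto
      ultimately show ?thesis by (simp add: mult.commute)
    qed
  qed
  moreover have "P x = x" if "x \<in> K" for x
    using that complex_vector.subspace_0[OF N(1)] by (intro uniq) auto
  ultimately show "\<exists>P. bounded_operator P \<and> range P \<subseteq> K \<and> (\<forall>x\<in>K. P x = x)"
    using P(1) by blast
next
  assume "\<exists>P. bounded_operator P \<and> range P \<subseteq> K \<and> (\<forall>x\<in>K. P x = x)"
  then obtain P where P: "bounded_operator P" "range P \<subseteq> K" "\<And>x. x \<in> K \<Longrightarrow> P x = x" by blast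
  have K: "K = range P"
  proof
    show "K \<subseteq> range P" using P(3) by (metis rangeI subsetI)
  qed (fact P(2))
  let ?Q = "\<lambda>x. x - P x"
  have Q: "bounded_operator ?Q"
    by (intro bounded_operator_diff bounded_operator_ident P)
  have "x \<in> K \<longleftrightarrow> x \<in> ker ?Q" for x
    using P(3)[of x] subsetD[OF P(2) rangeI, of x] by (auto simp: ker_def)
  then have "K = ker ?Q" by blast
  then have "closed K" using closed_ker[OF Q] by simp
  moreover have "K \<inter> ker P = {0}"
  proof
    show "K \<inter> ker P \<subseteq> {0}" using P(3) by (force simp: ker_def)
    show "{0} \<subseteq> K \<inter> ker P"
      using rangeI[of P 0] by (simp add: K ker_def bounded_operatorD(5)[OF P(1)])
  qed
  moreover have "K + ker P = UNIV"
  proof -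
    have "x \<in> K + ker P" for x
    proof -
      have "P x + (x - P x) \<in> K + ker P"
        using subsetD[OF P(2) rangeI, of x] P(3)[of "P x"]
        by (intro set_plus_intro) (simp_all add: ker_def bounded_operatorD(4)[OF P(1)])
      then show ?thesis by simp
    qed
    then show ?thesis by blast
  qed
  ultimately show "topologically_complemented K"
    unfolding topologically_complemented_def
    using subspace_range[OF P(1), folded K] subspace_ker[OF P(1)] closed_ker[OF P(1)]
    by (intro conjI exI[of _ "ker P"])
qed

section \<open>Lifting through an operator\<close>

text \<open>A bounded solution of \<open>T \<circ> C = B\<close> with values in \<open>range (T ^^ n)\<close>. It is this prescribed,
  possibly non-closed range that makes the lemma stronger than the fact that a surjective
  operator with complemented kernel has a bounded right inverse.\<close>
lemma lift_through_operator:
  assumes T: "bounded_operator T" and B: "bounded_operator B"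
    and "topologically_complemented (ker T \<inter> range (T ^^ n))"
    and range_B: "range B \<subseteq> range (T ^^ Suc n)"
  obtains C where "bounded_operator C" "range C \<subseteq> range (T ^^ n)" "\<And>x. T (C x) = B x"
proof -
  note Tn = bounded_operator_funpow[OF T, of n] and TSn = bounded_operator_funpow[OF T, of "Suc n"]
  note R = subspace_range[OF Tn]
  obtain P where P: "bounded_operator P" "range P \<subseteq> ker T \<inter> range (T ^^ n)"
    and P_id: "\<And>x. x \<in> ker T \<inter> range (T ^^ n) \<Longrightarrow> P x = x"
    using assms(3) unfolding topologically_complemented_iff_projection by blast
  (* F u is the preimage of (T ^^ Suc n) u under T that lies in range (T ^^ n) and is killed by P;
     these two conditions determine it, which is F_eq below. *)
  define F where "F u = (T ^^ n) u - P ((T ^^ n) u)" for u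
  have F: "bounded_operator F"
    unfolding F_def by (intro bounded_operator_diff bounded_operator_compose[OF P(1)] Tn)
  have F_range: "F u \<in> range (T ^^ n)" for u
    unfolding F_def using P(2) by (intro complex_vector.subspace_diff[OF R]) auto
  have TF: "T (F u) = (T ^^ Suc n) u" for u
    unfolding F_def using P(2) by (auto simp: bounded_operatorD(4)[OF T] ker_def)
  have F_eq: "F u = F v" if "(T ^^ Suc n) u = (T ^^ Suc n) v" for u v
  proof -
    have "(T ^^ n) (u - v) \<in> ker T \<inter> range (T ^^ n)"
      using that
      by (intro IntI rangeI) (simp add: ker_def bounded_operatorD(4)[OF T] bounded_operatorD(4)[OF Tn])
    then have "F (u - v) = 0" unfolding F_def by (simp add: P_id)
    then show ?thesis by (simp add: bounded_operatorD(4)[OF F])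
  qed
  let ?G = "{z. B (fst z) = (T ^^ Suc n) (snd z)}"
  have lin: "bounded_linear B" "bounded_linear (T ^^ Suc n)"
    using bounded_operatorD(1)[OF B] bounded_operatorD(1)[OF TSn] by auto
  have "subspace ?G"
    using lin[THEN bounded_linear.linear]
    by (auto simp: subspace_def linear_add linear_0 linear_scale simp del: funpow.simps)
  moreover have "closed ?G"
    by (intro closed_Collect_eq bounded_linear.continuous_on[OF lin(1)]
        bounded_linear.continuous_on[OF lin(2)] continuous_intros)
  moreover have ex: "\<exists>u. (x, u) \<in> ?G" for x using range_B by (auto simp del: funpow.simps)
  ultimately obtain M where "M > 0" and M: "\<And>x. \<exists>u. (x, u) \<in> ?G \<and> norm u \<le> M * norm x"
    using closed_relation_bounded_selection[of ?G] by blast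
  (* The selection s need not be linear, but F \<circ> s is, because of F_eq. *)
  then obtain s where s: "\<And>x. (T ^^ Suc n) (s x) = B x" "\<And>x. norm (s x) \<le> M * norm x"
    by (simp del: funpow.simps) metis
  obtain L where L: "\<And>u. norm (F u) \<le> norm u * L" "L \<ge> 0"
    using bounded_linear.nonneg_bounded[OF bounded_operatorD(1)[OF F]] by blast
  have C: "bounded_operator (\<lambda>x. F (s x))"
  proof (rule bounded_operatorI)
    show "F (s (x + y)) = F (s x) + F (s y)" for x y
      unfolding bounded_operatorD(3)[OF F, symmetric]
      by (rule F_eq) (simp only: s bounded_operatorD(3)[OF B] bounded_operatorD(3)[OF TSn])
    show "F (s (c *\<^sub>C x)) = c *\<^sub>C F (s x)" for c x
      unfolding bounded_operatorD(2)[OF F, symmetric]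
      by (rule F_eq) (simp only: s bounded_operatorD(2)[OF B] bounded_operatorD(2)[OF TSn])
    show "norm (F (s x)) \<le> norm x * (M * L)" for x
      using order_trans[OF L(1) mult_right_mono[OF s(2)[of x] L(2)]] by (simp add: mult_ac)
  qed
  show thesis
  proof (rule that[OF C])
    show "range (\<lambda>x. F (s x)) \<subseteq> range (T ^^ n)" using F_range by (rule image_subsetI)
    show "T (F (s x)) = B x" for x using TF s(1) by (rule trans)
  qed
qed

section \<open>Stable kernels\<close>

text \<open>In other words, the degree of stable iteration is at most \<open>n\<close>.\<close>
definition kernel_stable_from :: "('a::complex_banach \<Rightarrow> 'a) \<Rightarrow> nat \<Rightarrow> bool" where
  "kernel_stable_from T n \<longleftrightarrow> (\<forall>m\<ge>n. ker T \<inter> range (T ^^ n) = ker T \<inter> range (T ^^ m))"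

lemma range_funpow_mono:
  fixes T :: "'b \<Rightarrow> 'b"
  assumes "n \<le> m"
  shows "range (T ^^ m) \<subseteq> range (T ^^ n)"
proof -
  have "T ^^ m = T ^^ n \<circ> T ^^ (m - n)"
    using assms by (metis funpow_add le_add_diff_inverse)
  then show ?thesis by (metis image_comp image_mono subset_UNIV)
qed

lemma ker_funpow_mono:
  assumes "bounded_operator T" "n \<le> m"
  shows "ker (T ^^ n) \<subseteq> ker (T ^^ m)"
proof -
  have "T ^^ m = T ^^ (m - n) \<circ> T ^^ n"
    using assms(2) by (metis funpow_add le_add_diff_inverse2)
  then have "(T ^^ m) x = (T ^^ (m - n)) ((T ^^ n) x)" for x by simp
  then show ?thesis
    using bounded_operatorD(5)[OF bounded_operator_funpow[OF assms(1)]] by (auto simp: ker_def)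
qed

text \<open>Induction on \<open>j\<close>: if \<open>T x\<close> lies in \<open>range (T ^^ Suc m)\<close>, then \<open>x\<close> differs from an element of
  \<open>range (T ^^ m)\<close> by an element of \<open>ker T \<inter> range (T ^^ n)\<close>, which is itself in
  \<open>range (T ^^ m)\<close> by stability.\<close>
lemma ker_funpow_range_stable:
  assumes T: "bounded_operator T" and st: "kernel_stable_from T n" and "n \<le> m"
  shows "ker (T ^^ j) \<inter> range (T ^^ n) = ker (T ^^ j) \<inter> range (T ^^ m)"
proof -
  have "x \<in> range (T ^^ m)" if "x \<in> range (T ^^ n)" "(T ^^ j) x = 0" "n \<le> m" for x j m
    using that
  proof (induction j arbitrary: x m)
    case 0
    then show ?case
      using complex_vector.subspace_0[OF subspace_range[OF bounded_operator_funpow[OF T]]] by simp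
  next
    case (Suc j)
    have "T x \<in> range (T ^^ n)"
    proof -
      obtain w where "x = (T ^^ n) w" using Suc.prems(1) by blast
      then have "T x = (T ^^ n) (T w)" by (simp add: funpow_swap1)
      then show ?thesis by blast
    qed
    moreover have "(T ^^ j) (T x) = 0" using Suc.prems(2) by (simp add: funpow_swap1)
    ultimately have "T x \<in> range (T ^^ Suc m)" using Suc.IH Suc.prems(3) le_Suc_eq by blast
    then obtain y where y: "T x = T ((T ^^ m) y)" by auto
    have "x - (T ^^ m) y \<in> ker T \<inter> range (T ^^ n)"
      using y Suc.prems(1) subsetD[OF range_funpow_mono[OF Suc.prems(3)] rangeI]
      by (intro IntI complex_vector.subspace_diff[OF subspace_range[OF bounded_operator_funpow[OF T]]])
        (simp_all add: ker_def bounded_operatorD(4)[OF T])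
    then have "x - (T ^^ m) y \<in> range (T ^^ m)"
      using st Suc.prems(3) unfolding kernel_stable_from_def by blast
    then have "(x - (T ^^ m) y) + (T ^^ m) y \<in> range (T ^^ m)"
      by (intro complex_vector.subspace_add[OF subspace_range[OF bounded_operator_funpow[OF T]]]) auto
    then show ?case by simp
  qed
  then show ?thesis using range_funpow_mono[OF \<open>n \<le> m\<close>, of T] \<open>n \<le> m\<close> by (auto simp: ker_def)
qed

section \<open>Complements of stable kernels\<close>

text \<open>From \<open>j\<close> to \<open>Suc j\<close>: the stable kernel of \<open>T ^^ Suc j\<close> splits as the stable kernel of \<open>T\<close> plus
  a bounded lift of the stable kernel of \<open>T ^^ j\<close>, and the projections onto the two pieces add
  up.\<close>
lemma complemented_kernel_funpow:
  assumes T: "bounded_operator T" and st: "kernel_stable_from T n"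
    and compl: "topologically_complemented (ker T \<inter> range (T ^^ n))"
  shows "topologically_complemented (ker (T ^^ j) \<inter> range (T ^^ n))"
proof (induction j)
  case 0
  have "ker (T ^^ 0) \<inter> range (T ^^ n) = {0}"
    using complex_vector.subspace_0[OF subspace_range[OF bounded_operator_funpow[OF T, of n]]]
    by (auto simp: ker_def)
  then show ?case
    unfolding topologically_complemented_iff_projection
    by (intro exI[of _ "\<lambda>x. 0"]) (auto simp: bounded_operator_zero)
next
  case (Suc j)
  let ?K = "\<lambda>j. ker (T ^^ j) \<inter> range (T ^^ n)"
  note R = subspace_range[OF bounded_operator_funpow[OF T, of n]]
  obtain P where P: "bounded_operator P" "range P \<subseteq> ker T \<inter> range (T ^^ n)"
    and P_id: "\<And>x. x \<in> ker T \<inter> range (T ^^ n) \<Longrightarrow> P x = x"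
    using compl unfolding topologically_complemented_iff_projection by blast
  obtain Pj where Pj: "bounded_operator Pj" "range Pj \<subseteq> ?K j"
    and Pj_id: "\<And>x. x \<in> ?K j \<Longrightarrow> Pj x = x"
    using Suc.IH unfolding topologically_complemented_iff_projection by blast
  have "range (\<lambda>x. Pj (T x)) \<subseteq> range (T ^^ Suc n)"
  proof -
    have "?K j \<subseteq> range (T ^^ Suc n)"
      unfolding ker_funpow_range_stable[OF T st le_SucI[OF order_refl]] by (rule Int_lower2)
    from subsetD[OF this subsetD[OF Pj(2) rangeI]] show ?thesis by (rule image_subsetI)
  qed
  then obtain C where C: "bounded_operator C" "range C \<subseteq> range (T ^^ n)" "\<And>x. T (C x) = Pj (T x)"
    using lift_through_operator[OF T bounded_operator_compose[OF Pj(1) T] compl] by blast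
  define Q where "Q x = C x + P (x - C x)" for x
  have "bounded_operator Q"
    unfolding Q_def
    by (intro bounded_operator_add C bounded_operator_compose[OF P(1)] bounded_operator_diff
        bounded_operator_ident)
  moreover have "Q x \<in> ?K (Suc j)" for x
  proof
    have P_x: "P (x - C x) \<in> ker T \<inter> range (T ^^ n)" using P(2) by blast
    show "Q x \<in> range (T ^^ n)"
      unfolding Q_def using C(2) P_x by (intro complex_vector.subspace_add[OF R]) auto
    have "T (Q x) = Pj (T x)"
      using P_x by (simp add: Q_def bounded_operatorD(3)[OF T] C(3) ker_def)
    then show "Q x \<in> ker (T ^^ Suc j)"
      using Pj(2) by (auto simp: ker_def funpow_swap1)
  qed
  moreover have "Q x = x" if x: "x \<in> ?K (Suc j)" for x
  proof -
    obtain w where w: "x = (T ^^ n) w" using x by blast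
    then have "T x \<in> range (T ^^ n)" by (auto simp: funpow_swap1)
    then have "Pj (T x) = T x"
      using x by (intro Pj_id) (auto simp: ker_def funpow_swap1)
    then have "x - C x \<in> ker T \<inter> range (T ^^ n)"
      using x subsetD[OF C(2) rangeI]
      by (intro IntI complex_vector.subspace_diff[OF R])
        (simp_all add: ker_def bounded_operatorD(4)[OF T] C(3))
    then show ?thesis by (simp add: Q_def P_id)
  qed
  ultimately show ?case
    unfolding topologically_complemented_iff_projection by blast
qed

text \<open>Lifting the projection \<open>P\<close> onto the stable kernel of \<open>T ^^ m\<close> through \<open>T ^^ m\<close> yields an operator
  \<open>C\<close> such that \<open>(T ^^ (m - 1)) \<circ> C\<close> inverts \<open>T\<close> from the right on that kernel. Subtracting
  \<open>(T ^^ (m - 1)) (C (T y))\<close> from \<open>y\<close> therefore sends the stable kernel of \<open>T ^^ m\<close> onto that of \<open>T\<close>.\<close>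
lemma complemented_kernel_of_funpow:
  assumes T: "bounded_operator T" and "m \<ge> 1" and st: "kernel_stable_from (T ^^ m) k"
    and compl: "topologically_complemented (ker (T ^^ m) \<inter> range (T ^^ (m * k)))"
  shows "topologically_complemented (ker T \<inter> range (T ^^ (m * k)))"
proof -
  let ?K = "ker (T ^^ m) \<inter> range (T ^^ (m * k))"
  note Tm = bounded_operator_funpow[OF T, of m]
  note R = subspace_range[OF bounded_operator_funpow[OF T, of "m * k"]]
  obtain P where P: "bounded_operator P" "range P \<subseteq> ?K" and P_id: "\<And>x. x \<in> ?K \<Longrightarrow> P x = x"
    using compl unfolding topologically_complemented_iff_projection by blast
  have T_R: "(T ^^ i) x \<in> range (T ^^ (m * k))" if x: "x \<in> range (T ^^ (m * k))" for x i
  proof -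
    obtain w where w: "x = (T ^^ (m * k)) w" using x by blast
    have "(T ^^ i) x = (T ^^ (i + m * k)) w" by (simp only: w funpow_add o_apply)
    also have "\<dots> = (T ^^ (m * k + i)) w" by (simp only: add.commute)
    also have "\<dots> = (T ^^ (m * k)) ((T ^^ i) w)" by (simp only: funpow_add o_apply)
    finally show ?thesis by (rule range_eqI)
  qed
  have "range P \<subseteq> range ((T ^^ m) ^^ Suc k)"
  proof -
    have "ker (T ^^ m) \<inter> range ((T ^^ m) ^^ k) = ker (T ^^ m) \<inter> range ((T ^^ m) ^^ Suc k)"
      using st unfolding kernel_stable_from_def by (meson le_SucI order_refl)
    then have "?K \<subseteq> range ((T ^^ m) ^^ Suc k)"
      unfolding funpow_mult by blast
    with P(2) show ?thesis by (rule subset_trans)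
  qed
  moreover have "topologically_complemented (ker (T ^^ m) \<inter> range ((T ^^ m) ^^ k))"
    using compl by (simp add: funpow_mult)
  ultimately obtain C where C: "bounded_operator C" "range C \<subseteq> range ((T ^^ m) ^^ k)"
    "\<And>x. (T ^^ m) (C x) = P x"
    using lift_through_operator[OF Tm P(1)] by blast
  have C_R: "C x \<in> range (T ^^ (m * k))" for x using C(2) by (auto simp: funpow_mult)
  define Q where "Q x = P x - (T ^^ (m - 1)) (C (T (P x)))" for x
  have "bounded_operator Q"
    unfolding Q_def
    by (intro bounded_operator_diff P bounded_operator_compose[OF bounded_operator_funpow[OF T]]
        bounded_operator_compose[OF C(1)] bounded_operator_compose[OF T])
  moreover have "Q x \<in> ker T \<inter> range (T ^^ (m * k))" for x
  proof
    have Px: "P x \<in> ?K" using P(2) by blast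
    show "Q x \<in> range (T ^^ (m * k))"
      unfolding Q_def using Px T_R C_R by (intro complex_vector.subspace_diff[OF R]) auto
    have "T (P x) \<in> ?K"
      using Px T_R[of "P x" 1] bounded_operatorD(5)[OF T] by (auto simp: ker_def simp flip: funpow_swap1)
    moreover have "T ((T ^^ (m - 1)) y) = (T ^^ m) y" for y
      using \<open>m \<ge> 1\<close> by (cases m) auto
    ultimately have "T (Q x) = 0"
      by (simp add: Q_def bounded_operatorD(4)[OF T] C(3) P_id)
    then show "Q x \<in> ker T" by (simp add: ker_def)
  qed
  moreover have "Q x = x" if "x \<in> ker T \<inter> range (T ^^ (m * k))" for x
  proof -
    have "P x = x" using that ker_funpow_mono[OF T \<open>m \<ge> 1\<close>] by (intro P_id) auto
    then show ?thesis
      using that bounded_operatorD(5)[OF C(1)] bounded_operatorD(5)[OF bounded_operator_funpow[OF T]]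
      by (simp add: Q_def ker_def)
  qed
  ultimately show ?thesis
    unfolding topologically_complemented_iff_projection by blast
qed

section \<open>Stability and descent of powers\<close>

lemma kernel_stable_from_funpow:
  assumes "bounded_operator T" "kernel_stable_from T n" "m \<ge> 1"
  shows "kernel_stable_from (T ^^ m) n"
  unfolding kernel_stable_from_def
proof (intro allI impI)
  fix k assume "n \<le> k"
  have "n \<le> m * n" "n \<le> m * k" using \<open>m \<ge> 1\<close> \<open>n \<le> k\<close> by (cases m; simp)+
  then show "ker (T ^^ m) \<inter> range ((T ^^ m) ^^ n) = ker (T ^^ m) \<inter> range ((T ^^ m) ^^ k)"
    unfolding funpow_mult using ker_funpow_range_stable[OF assms(1,2), of _ m] by blast
qed

lemma kernel_stable_from_of_funpow:
  assumes T: "bounded_operator T" and st: "kernel_stable_from (T ^^ m) k" and "m \<ge> 1"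
  shows "kernel_stable_from T (m * k)"
  unfolding kernel_stable_from_def
proof (intro allI impI)
  fix j assume j: "m * k \<le> j"
  have "k \<le> m * k" "j \<le> m * j" using \<open>m \<ge> 1\<close> by (cases m; simp)+
  then have "k \<le> j" using j by linarith
  have "ker T \<subseteq> ker (T ^^ m)" using ker_funpow_mono[OF T \<open>m \<ge> 1\<close>] by simp
  then have "ker T \<inter> range (T ^^ (m * k)) \<subseteq> ker (T ^^ m) \<inter> range ((T ^^ m) ^^ k)"
    unfolding funpow_mult by (rule Int_mono) simp
  also have "\<dots> = ker (T ^^ m) \<inter> range ((T ^^ m) ^^ j)"
    using st \<open>k \<le> j\<close> unfolding kernel_stable_from_def by simp
  also have "\<dots> \<subseteq> range (T ^^ j)"
    unfolding funpow_mult using range_funpow_mono[OF \<open>j \<le> m * j\<close>] by (rule le_infI2)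
  finally show "ker T \<inter> range (T ^^ (m * k)) = ker T \<inter> range (T ^^ j)"
    using range_funpow_mono[OF j, of T] by blast
qed

lemma range_funpow_stable:
  fixes T :: "'b \<Rightarrow> 'b"
  assumes "range (T ^^ n) = range (T ^^ Suc n)" "n \<le> m"
  shows "range (T ^^ m) = range (T ^^ n)"
  using assms(2)
proof (induction m rule: dec_induct)
  case (step m)
  have "range (T ^^ Suc m) = T ` range (T ^^ m)" by (simp add: image_comp)
  also have "\<dots> = range (T ^^ Suc n)" unfolding step.IH by (simp add: image_comp)
  finally show ?case using assms(1) by simp
qed simp

lemma kernel_stable_from_range_stable:
  "range (T ^^ n) = range (T ^^ Suc n) \<Longrightarrow> kernel_stable_from T n"
  unfolding kernel_stable_from_def by (metis range_funpow_stable)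

section \<open>Right Drazin invertibility without infima\<close>

lemma Inf_enat_attained: "Inf {enat n | n. P n} = enat q \<Longrightarrow> P q"
  using LeastI_ex[of "\<lambda>x. x \<in> {enat n | n. P n}"] by (auto simp: Inf_enat_def split: if_splits)

lemma Inf_enat_finite:
  assumes "P n"
  obtains q where "Inf {enat n | n. P n} = enat q" "q \<le> n"
proof -
  have "Inf {enat n | n. P n} \<le> enat n" using assms by (intro Inf_lower) auto
  then obtain q where "Inf {enat n | n. P n} = enat q" using enat_ile by blast
  moreover from this have "q \<le> n" using \<open>Inf {enat n | n. P n} \<le> enat n\<close> by simp
  ultimately show thesis by (rule that)
qed

lemma Inf_enat_less_infinity: "Inf {enat n | n. P n} < \<infinity> \<longleftrightarrow> (\<exists>n. P n)"
proof
  assume "Inf {enat n | n. P n} < \<infinity>"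
  then obtain q where "Inf {enat n | n. P n} = enat q" by (rule less_infinityE)
  then have "P q" by (rule Inf_enat_attained)
  then show "\<exists>n. P n" ..
next
  assume "\<exists>n. P n"
  then obtain n where "P n" ..
  then obtain q where "Inf {enat n | n. P n} = enat q" by (rule Inf_enat_finite)
  then show "Inf {enat n | n. P n} < \<infinity>" by simp
qed

text \<open>The descent may be replaced by any later index, since the ranges agree from there on. This
  spares computing the descent of \<open>T ^^ m\<close>.\<close>
lemma right_drazin_invertible_iff:
  "right_drazin_invertible T \<longleftrightarrow>
    (\<exists>n. range (T ^^ n) = range (T ^^ Suc n) \<and> topologically_complemented (ker T \<inter> range (T ^^ n)))"
proof
  assume "right_drazin_invertible T"
  then obtain q where q: "descent T = enat q" "topologically_complemented (ker T \<inter> range (T ^^ q))"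
    unfolding right_drazin_invertible_def by blast
  have "range (T ^^ q) = range (T ^^ (q + 1))"
    using q(1) unfolding descent_def by (rule Inf_enat_attained)
  then show "\<exists>n. range (T ^^ n) = range (T ^^ Suc n) \<and>
      topologically_complemented (ker T \<inter> range (T ^^ n))"
    using q(2) unfolding Suc_eq_plus1 by blast
next
  assume "\<exists>n. range (T ^^ n) = range (T ^^ Suc n) \<and>
      topologically_complemented (ker T \<inter> range (T ^^ n))"
  then obtain n where n: "range (T ^^ n) = range (T ^^ (n + 1))"
    "topologically_complemented (ker T \<inter> range (T ^^ n))"
    unfolding Suc_eq_plus1 by blast
  obtain q where q: "descent T = enat q" "q \<le> n"
    using Inf_enat_finite[where P = "\<lambda>n. range (T ^^ n) = range (T ^^ (n + 1))", OF n(1)]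
    unfolding descent_def by blast
  have "range (T ^^ q) = range (T ^^ (q + 1))"
    using q(1) unfolding descent_def by (rule Inf_enat_attained)
  then have "range (T ^^ n) = range (T ^^ q)"
    using range_funpow_stable q(2) unfolding Suc_eq_plus1 by blast
  then show "right_drazin_invertible T"
    unfolding right_drazin_invertible_def using q(1) n(2) by auto
qed

lemma dis_eq: "dis T = Inf {enat n | n. kernel_stable_from T n}"
proof -
  have "(\<forall>m. m \<ge> n \<and> m \<ge> 1 \<longrightarrow> ker T \<inter> range (T ^^ n) = ker T \<inter> range (T ^^ m)) \<longleftrightarrow>
      kernel_stable_from T n" (is "?L \<longleftrightarrow> _") for n
  proof
    assume L: ?L
    show "kernel_stable_from T n"
      unfolding kernel_stable_from_def
    proof (intro allI impI)
      fix m assume "n \<le> m"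
      show "ker T \<inter> range (T ^^ n) = ker T \<inter> range (T ^^ m)"
      proof (cases "m = 0")
        case False
        then have "m \<ge> 1" by simp
        with \<open>n \<le> m\<close> show ?thesis by (intro L[rule_format] conjI)
      qed (use \<open>n \<le> m\<close> in simp)
    qed
  next
    assume "kernel_stable_from T n"
    then show ?L unfolding kernel_stable_from_def by (elim all_forward imp_forward conjunct1)
  qed
  then show ?thesis unfolding dis_def by (simp only:)
qed

lemma essentially_right_drazin_invertible_iff:
  "essentially_right_drazin_invertible T \<longleftrightarrow> essential_descent T < \<infinity> \<and>
    (\<exists>n. kernel_stable_from T n \<and> topologically_complemented (ker T \<inter> range (T ^^ n)))"
proof -
  have "(\<exists>n. dis T = enat n \<and> topologically_complemented (ker T \<inter> range (T ^^ n))) \<longleftrightarrow>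
    (\<exists>n. kernel_stable_from T n \<and> topologically_complemented (ker T \<inter> range (T ^^ n)))"
    (is "?L \<longleftrightarrow> ?R")
  proof
    assume ?L
    then show ?R unfolding dis_eq by (blast dest: Inf_enat_attained)
  next
    assume ?R
    then obtain n where n: "kernel_stable_from T n"
      "topologically_complemented (ker T \<inter> range (T ^^ n))" by blast
    obtain q where q: "dis T = enat q" "q \<le> n"
      using Inf_enat_finite[where P = "kernel_stable_from T", OF n(1)] unfolding dis_eq by blast
    have "kernel_stable_from T q" using q(1) unfolding dis_eq by (rule Inf_enat_attained)
    then have "ker T \<inter> range (T ^^ q) = ker T \<inter> range (T ^^ n)"
      using q(2) unfolding kernel_stable_from_def by blast
    then show ?L using q(1) n(2) by auto
  qed
  then show ?thesis unfolding essentially_right_drazin_invertible_def by simp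
qed

section \<open>Finite essential descent\<close>

lemma codim_finite_iff:
  "codim M < \<infinity> \<longleftrightarrow> (\<exists>B. finite B \<and> complex_vector.span (M \<union> B) = UNIV)"
proof -
  have "{enat (card B) | B. finite B \<and> complex_vector.span (M \<union> B) = UNIV} =
      {enat n | n. \<exists>B. n = card B \<and> finite B \<and> complex_vector.span (M \<union> B) = UNIV}"
    by blast
  then have "codim M =
      Inf {enat n | n. \<exists>B. n = card B \<and> finite B \<and> complex_vector.span (M \<union> B) = UNIV}"
    unfolding codim_def by (rule arg_cong)
  then show ?thesis by (simp only: Inf_enat_less_infinity) blast
qed

lemma codim_sum_finite_iff:
  assumes "complex_vector.subspace M" "complex_vector.subspace N"
  shows "codim (M + N) < \<infinity> \<longleftrightarrow> (\<exists>B. finite B \<and> complex_vector.span (M \<union> N \<union> B) = UNIV)"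
proof -
  have "complex_vector.span (M + N \<union> B) = complex_vector.span (M \<union> N \<union> B)" for B
  proof (rule antisym; rule complex_vector.span_minimal)
    show "M + N \<union> B \<subseteq> complex_vector.span (M \<union> N \<union> B)"
      by (auto elim!: set_plus_elim intro: complex_vector.span_add complex_vector.span_base)
    have "m \<in> M + N" if "m \<in> M" for m
      using set_plus_intro[OF that complex_vector.subspace_0[OF assms(2)]] by simp
    moreover have "n \<in> M + N" if "n \<in> N" for n
      using set_plus_intro[OF complex_vector.subspace_0[OF assms(1)] that] by simp
    ultimately show "M \<union> N \<union> B \<subseteq> complex_vector.span (M + N \<union> B)"
      by (auto intro: complex_vector.span_base)
  qed (rule complex_vector.subspace_span)+
  then show ?thesis unfolding codim_finite_iff by (simp only:)
qed

lemma essential_descent_finite_iff: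
  assumes T: "bounded_operator T"
  shows "essential_descent T < \<infinity> \<longleftrightarrow>
    (\<exists>n B. finite B \<and> complex_vector.span (range T \<union> ker (T ^^ n) \<union> B) = UNIV)"
  unfolding essential_descent_def Inf_enat_less_infinity
  by (simp only: codim_sum_finite_iff[OF subspace_range[OF T]
        subspace_ker[OF bounded_operator_funpow[OF T]]])

text \<open>Applying \<open>T\<close> to a spanning set made of \<open>range (T ^^ m)\<close>, \<open>ker (T ^^ n)\<close> and a finite set \<open>B'\<close> shows
  that \<open>range T\<close> is spanned by \<open>range (T ^^ Suc m)\<close>, a part of \<open>ker (T ^^ n)\<close> and \<open>T ` B'\<close>. Hence
  \<open>range T\<close> can be exchanged for \<open>range (T ^^ Suc m)\<close> in the given spanning set.\<close>
lemma cofinite_range_funpow: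
  assumes T: "bounded_operator T"
    and B: "finite B" "complex_vector.span (range T \<union> ker (T ^^ n) \<union> B) = UNIV"
  shows "\<exists>B. finite B \<and> complex_vector.span (range (T ^^ m) \<union> ker (T ^^ n) \<union> B) = UNIV"
proof (induction m)
  case 0
  have "complex_vector.span (range (T ^^ 0) \<union> ker (T ^^ n) \<union> {}) = UNIV" by simp
  then show ?case by blast
next
  case (Suc m)
  then obtain B' where B': "finite B'"
    "complex_vector.span (range (T ^^ m) \<union> ker (T ^^ n) \<union> B') = UNIV" by blast
  let ?S = "complex_vector.span (range (T ^^ Suc m) \<union> ker (T ^^ n) \<union> (T ` B' \<union> B))"
  have "T x \<in> ?S" for x
  proof -
    have "x \<in> complex_vector.span (range (T ^^ m) \<union> ker (T ^^ n) \<union> B')" using B'(2) by simp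
    then show ?thesis
    proof (rule complex_vector.span_induct)
      show "complex_vector.subspace {x. T x \<in> ?S}"
        by (simp add: complex_vector.subspace_def bounded_operatorD[OF T] complex_vector.span_zero
            complex_vector.span_add complex_vector.span_scale)
    next
      fix y assume y: "y \<in> range (T ^^ m) \<union> ker (T ^^ n) \<union> B'"
      have "T y \<in> ker (T ^^ n)" if "y \<in> ker (T ^^ n)"
        using that bounded_operatorD(5)[OF T] by (simp add: ker_def flip: funpow_swap1)
      then show "T y \<in> ?S" using y by (intro complex_vector.span_base) auto
    qed
  qed
  then have "range T \<union> ker (T ^^ n) \<union> B \<subseteq> ?S"
    by (auto intro: complex_vector.span_base)
  then have "complex_vector.span (range T \<union> ker (T ^^ n) \<union> B) \<subseteq> ?S"
    by (rule complex_vector.span_minimal) (rule complex_vector.subspace_span)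
  then have "?S = UNIV" unfolding B(2) by (rule top.extremum_uniqueI)
  then show ?case using B(1) B'(1) by (intro exI[of _ "T ` B' \<union> B"]) simp
qed

lemma essential_descent_funpow_finite_iff:
  assumes T: "bounded_operator T" and "m \<ge> 1"
  shows "essential_descent (T ^^ m) < \<infinity> \<longleftrightarrow> essential_descent T < \<infinity>"
proof
  assume "essential_descent (T ^^ m) < \<infinity>"
  then obtain n B where B: "finite B"
    "complex_vector.span (range (T ^^ m) \<union> ker (T ^^ (m * n)) \<union> B) = UNIV"
    unfolding essential_descent_finite_iff[OF bounded_operator_funpow[OF T]] funpow_mult by blast
  have "range (T ^^ m) \<subseteq> range T" using range_funpow_mono[OF \<open>m \<ge> 1\<close>, of T] by simp
  then have "complex_vector.span (range (T ^^ m) \<union> ker (T ^^ (m * n)) \<union> B) \<subseteq>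
      complex_vector.span (range T \<union> ker (T ^^ (m * n)) \<union> B)"
    by (intro complex_vector.span_mono Un_mono order_refl)
  then have "complex_vector.span (range T \<union> ker (T ^^ (m * n)) \<union> B) = UNIV"
    unfolding B(2) by (rule top.extremum_uniqueI)
  then show "essential_descent T < \<infinity>"
    unfolding essential_descent_finite_iff[OF T] using B(1) by blast
next
  assume "essential_descent T < \<infinity>"
  then obtain n B\<^sub>1 where "finite B\<^sub>1" "complex_vector.span (range T \<union> ker (T ^^ n) \<union> B\<^sub>1) = UNIV"
    unfolding essential_descent_finite_iff[OF T] by blast
  from cofinite_range_funpow[OF T this]
  obtain B where B: "finite B" "complex_vector.span (range (T ^^ m) \<union> ker (T ^^ n) \<union> B) = UNIV"
    by blast
  have "n \<le> m * n" using \<open>m \<ge> 1\<close> by (cases m) auto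
  then have "complex_vector.span (range (T ^^ m) \<union> ker (T ^^ n) \<union> B) \<subseteq>
      complex_vector.span (range (T ^^ m) \<union> ker (T ^^ (m * n)) \<union> B)"
    by (intro complex_vector.span_mono Un_mono order_refl ker_funpow_mono[OF T])
  then have "complex_vector.span (range (T ^^ m) \<union> ker (T ^^ (m * n)) \<union> B) = UNIV"
    unfolding B(2) by (rule top.extremum_uniqueI)
  then show "essential_descent (T ^^ m) < \<infinity>"
    unfolding essential_descent_finite_iff[OF bounded_operator_funpow[OF T]] funpow_mult
    using B(1) by blast
qed

section \<open>Passing to powers\<close>

lemma complemented_stable_kernel_funpow_iff:
  assumes T: "bounded_operator T" and "m \<ge> 1" and st: "kernel_stable_from T n"
  shows "topologically_complemented (ker (T ^^ m) \<inter> range (T ^^ n)) \<longleftrightarrow>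
    topologically_complemented (ker T \<inter> range (T ^^ n))"
proof
  assume "topologically_complemented (ker (T ^^ m) \<inter> range (T ^^ n))"
  have "n \<le> m * n" using \<open>m \<ge> 1\<close> by (cases m) auto
  note eq = ker_funpow_range_stable[OF T st \<open>n \<le> m * n\<close>]
  have "ker T \<inter> range (T ^^ n) = ker T \<inter> range (T ^^ (m * n))"
    using eq[of 1] by simp
  moreover have "topologically_complemented (ker T \<inter> range (T ^^ (m * n)))"
    using \<open>topologically_complemented (ker (T ^^ m) \<inter> range (T ^^ n))\<close> unfolding eq
    by (rule complemented_kernel_of_funpow[OF T \<open>m \<ge> 1\<close> kernel_stable_from_funpow[OF T st \<open>m \<ge> 1\<close>]])
  ultimately show "topologically_complemented (ker T \<inter> range (T ^^ n))" by simp
qed (rule complemented_kernel_funpow[OF T st])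

lemma right_drazin_invertible_funpow_iff:
  assumes T: "bounded_operator T" and "m \<ge> 1"
  shows "right_drazin_invertible (T ^^ m) \<longleftrightarrow> right_drazin_invertible T"
proof
  assume "right_drazin_invertible (T ^^ m)"
  then obtain k where k: "range ((T ^^ m) ^^ k) = range ((T ^^ m) ^^ Suc k)"
    "topologically_complemented (ker (T ^^ m) \<inter> range ((T ^^ m) ^^ k))"
    unfolding right_drazin_invertible_iff by blast
  have "Suc (m * k) \<le> m * Suc k" using \<open>m \<ge> 1\<close> by simp
  then have "range (T ^^ (m * Suc k)) \<subseteq> range (T ^^ Suc (m * k))" by (rule range_funpow_mono)
  moreover have "range (T ^^ Suc (m * k)) \<subseteq> range (T ^^ (m * k))" by (rule range_funpow_mono) simp
  ultimately have eq: "range (T ^^ (m * k)) = range (T ^^ Suc (m * k))"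
    using k(1) unfolding funpow_mult by (metis subset_antisym)
  then have "topologically_complemented (ker T \<inter> range (T ^^ (m * k)))"
    using k(2) complemented_stable_kernel_funpow_iff[OF T \<open>m \<ge> 1\<close> kernel_stable_from_range_stable]
    unfolding funpow_mult by blast
  then show "right_drazin_invertible T" unfolding right_drazin_invertible_iff using eq by blast
next
  assume "right_drazin_invertible T"
  then obtain n where n: "range (T ^^ n) = range (T ^^ Suc n)"
    "topologically_complemented (ker T \<inter> range (T ^^ n))"
    unfolding right_drazin_invertible_iff by blast
  have le: "n \<le> m * n" "n \<le> m * Suc n" using \<open>m \<ge> 1\<close> by (cases m; simp)+
  note eq = le[THEN range_funpow_stable[OF n(1)]]
  have "topologically_complemented (ker (T ^^ m) \<inter> range (T ^^ n))"
    using n complemented_stable_kernel_funpow_iff[OF T \<open>m \<ge> 1\<close> kernel_stable_from_range_stable] by blast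
  then show "right_drazin_invertible (T ^^ m)"
    unfolding right_drazin_invertible_iff funpow_mult
    by (intro exI[of _ n]) (simp only: eq)
qed

lemma essentially_right_drazin_invertible_funpow_iff:
  assumes T: "bounded_operator T" and "m \<ge> 1"
  shows "essentially_right_drazin_invertible (T ^^ m) \<longleftrightarrow> essentially_right_drazin_invertible T"
proof -
  have "(\<exists>n. kernel_stable_from (T ^^ m) n \<and>
      topologically_complemented (ker (T ^^ m) \<inter> range ((T ^^ m) ^^ n))) \<longleftrightarrow>
    (\<exists>n. kernel_stable_from T n \<and> topologically_complemented (ker T \<inter> range (T ^^ n)))"
    (is "?L \<longleftrightarrow> ?R")
  proof
    assume ?L
    then obtain k where k: "kernel_stable_from (T ^^ m) k"
      "topologically_complemented (ker (T ^^ m) \<inter> range (T ^^ (m * k)))"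
      unfolding funpow_mult by blast
    have "kernel_stable_from T (m * k)"
      by (rule kernel_stable_from_of_funpow[OF T k(1) \<open>m \<ge> 1\<close>])
    then show ?R using complemented_stable_kernel_funpow_iff[OF T \<open>m \<ge> 1\<close>] k(2) by blast
  next
    assume ?R
    then obtain n where n: "kernel_stable_from T n"
      "topologically_complemented (ker T \<inter> range (T ^^ n))" by blast
    have "n \<le> m * n" using \<open>m \<ge> 1\<close> by (cases m) auto
    then have "topologically_complemented (ker (T ^^ m) \<inter> range ((T ^^ m) ^^ n))"
      unfolding funpow_mult ker_funpow_range_stable[OF T n(1) \<open>n \<le> m * n\<close>, symmetric]
      using complemented_stable_kernel_funpow_iff[OF T \<open>m \<ge> 1\<close> n(1)] n(2) by blast
    then show ?L using kernel_stable_from_funpow[OF T n(1) \<open>m \<ge> 1\<close>] by blast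
  qed
  then show ?thesis
    unfolding essentially_right_drazin_invertible_iff
      essential_descent_funpow_finite_iff[OF T \<open>m \<ge> 1\<close>] by (simp only:)
qed

theorem theorem4p2:
  fixes T :: "'a::complex_banach \<Rightarrow> 'a"
  assumes infinite_dimensional: "\<not> (\<exists>B::'a set. finite B \<and> complex_vector.span B = UNIV)"
    and T: "bounded_operator T"
  shows "(right_drazin_invertible T \<longleftrightarrow> (\<forall>m\<ge>1. right_drazin_invertible (T ^^ m))) \<and>
    ((\<forall>m\<ge>1. right_drazin_invertible (T ^^ m)) \<longleftrightarrow> (\<exists>m\<ge>1. right_drazin_invertible (T ^^ m))) \<and>
    (essentially_right_drazin_invertible T \<longleftrightarrow>
      (\<forall>m\<ge>1. essentially_right_drazin_invertible (T ^^ m))) \<and>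
    ((\<forall>m\<ge>1. essentially_right_drazin_invertible (T ^^ m)) \<longleftrightarrow>
      (\<exists>m\<ge>1. essentially_right_drazin_invertible (T ^^ m)))"
  using right_drazin_invertible_funpow_iff[OF T] essentially_right_drazin_invertible_funpow_iff[OF T]
  by (metis order_refl)

end
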